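(* Let $d \geq 1$ and let $P=\{p_1,\ldots,p_d\}$ and $Q=\{q_1,\ldots,q_d\}$ be any partially ordered sets with $|P|=|Q|=d$. Then the convex polytope $\Gamma(\mathcal{O}(P), -\mathcal{C}(Q)) \subset \mathbb{R}^d$, defined as the convex hull of $\mathcal{O}(P) \cup (-\mathcal{C}(Q))$, where $\mathcal{O}(P)$ is the order polytope of $P$ and $\mathcal{C}(Q)$ is the chain polytope of $Q$, is a normal Gorenstein Fano polytope.
   Context: Poset ideals and antichains. A subset $I \subset P$ is a poset ideal of $P$ if $p_i \in I$, $p_j \in P$ and $p_j \leq p_i$ imply $p_j \in I$ (so $\emptyset$ and $P$ are poset ideals). $\mathcal{J}(P)$ denotes the set of poset ideals of $P$. A subset $A \subset Q$ is an antichain of $Q$ if any two distinct elements of $A$ are incomparable in $Q$ (so $\emptyset$ and all one-element subsets are antichains). $\mathcal{A}(Q)$ denotes the set of antichains of $Q$. Polytopes. Let $\mathbf{e}_1,\ldots,\mathbf{e}_d$ be the canonical unit coordinate vectors of $\mathbb{R}^d$. For $I \subset P$ put $\rho(I)=\sum_{p_i \in I}\mathbf{e}_i$, and for $J \subset Q$ put $\rho(J)=\sum_{q_j\in J}\mathbf{e}_j$; in particular $\rho(\emptyset)=\mathbf{0}$. The order polytope $\mathcal{O}(P)$ is the convex hull of $\{\rho(I) \mid I \in \mathcal{J}(P)\}$. The chain polytope $\mathcal{C}(Q)$ is the convex hull of $\{\rho(A) \mid A \in \mathcal{A}(Q)\}$. Write $-\mathcal{C}(Q)=\{-\beta \mid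 \beta\in\mathcal{C}(Q)\}$. Properties of polytopes. A convex polytope $\mathcal{P}\subset\mathbb{R}^d$ is integral if all its vertices belong to $\mathbb{Z}^d$. An integral convex polytope $\mathcal{P}$ is normal if, for each integer $N>0$ and each $\mathbf{a}\in N\mathcal{P}\cap\mathbb{Z}^d$, there exist $\mathbf{a}_1,\ldots,\mathbf{a}_N\in\mathcal{P}\cap\mathbb{Z}^d$ with $\mathbf{a}=\mathbf{a}_1+\cdots+\mathbf{a}_N$, where $N\mathcal{P}=\{N\alpha \mid \alpha\in\mathcal{P}\}$. An integral convex polytope $\mathcal{P}\subset\mathbb{R}^d$ is Fano if the origin of $\mathbb{R}^d$ is the unique integer point belonging to the interior of $\mathcal{P}$. A Fano polytope $\mathcal{P}$ is Gorenstein (also called reflexive) if its dual polytope $\mathcal{P}^{\vee}=\{\mathbf{x}\in\mathbb{R}^d \mid \langle\mathbf{x},\mathbf{y}\rangle\leq 1 \text{ for all } \mathbf{y}\in\mathcal{P}\}$ is integral as well. *)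

theory Defs
  imports "HOL-Analysis.Analysis"
begin

text \<open>
  A finite poset is a carrier set \<open>P\<close> with a relation \<open>r\<close> satisfying \<^const>\<open>partial_order_on\<close>;
  \<open>(x, y) \<in> r\<close> means \<open>x \<le> y\<close>. The enumeration \<open>p\<^sub>1, \<dots>, p\<^sub>d\<close> of its elements is a bijection \<open>p\<close>
  from the finite index type \<open>'n\<close> of the ambient space \<^typ>\<open>real ^ 'n\<close> onto \<open>P\<close>, so \<open>d = CARD('n)\<close>.
\<close>

definition poset_ideals :: "'a set \<Rightarrow> ('a \<times> 'a) set \<Rightarrow> 'a set set" where
  "poset_ideals P r = {I. I \<subseteq> P \<and> (\<forall>x\<in>I. \<forall>y\<in>P. (y, x) \<in> r \<longrightarrow> y \<in> I)}"

definition antichains :: "'a set \<Rightarrow> ('a \<times> 'a) set \<Rightarrow> 'a set set" where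
  "antichains P r =
    {A. A \<subseteq> P \<and> (\<forall>x\<in>A. \<forall>y\<in>A. x \<noteq> y \<longrightarrow> (x, y) \<notin> r \<and> (y, x) \<notin> r)}"

definition rho :: "('n::finite \<Rightarrow> 'a) \<Rightarrow> 'a set \<Rightarrow> real ^ 'n" where
  "rho p I = (\<Sum>i | p i \<in> I. axis i 1)"

definition order_polytope ::
    "'a set \<Rightarrow> ('a \<times> 'a) set \<Rightarrow> ('n::finite \<Rightarrow> 'a) \<Rightarrow> (real ^ 'n) set" where
  "order_polytope P r p = convex hull (rho p ` poset_ideals P r)"

definition chain_polytope ::
    "'a set \<Rightarrow> ('a \<times> 'a) set \<Rightarrow> ('n::finite \<Rightarrow> 'a) \<Rightarrow> (real ^ 'n) set" where
  "chain_polytope P r p = convex hull (rho p ` antichains P r)"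

definition Gamma_polytope :: "(real ^ 'n) set \<Rightarrow> (real ^ 'n) set \<Rightarrow> (real ^ 'n) set" where
  "Gamma_polytope S T = convex hull (S \<union> T)"

definition integer_points :: "(real ^ 'n) set" where
  "integer_points = {x. \<forall>i. x $ i \<in> \<int>}"

definition integral_polytope :: "(real ^ 'n) set \<Rightarrow> bool" where
  "integral_polytope S \<longleftrightarrow> polytope S \<and> (\<forall>v. v extreme_point_of S \<longrightarrow> v \<in> integer_points)"

definition normal_polytope :: "(real ^ 'n) set \<Rightarrow> bool" where
  "normal_polytope S \<longleftrightarrow> integral_polytope S \<and>
    (\<forall>N::nat. N > 0 \<longrightarrow>
      (\<forall>a \<in> (\<lambda>x. real N *\<^sub>R x) ` S \<inter> integer_points.
        \<exists>b :: nat \<Rightarrow> real ^ 'n.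
          (\<forall>k\<in>{1..N}. b k \<in> S \<inter> integer_points) \<and> a = (\<Sum>k=1..N. b k)))"

definition Fano_polytope :: "(real ^ 'n) set \<Rightarrow> bool" where
  "Fano_polytope S \<longleftrightarrow> integral_polytope S \<and> interior S \<inter> integer_points = {0}"

definition dual_polytope :: "(real ^ 'n) set \<Rightarrow> (real ^ 'n) set" where
  "dual_polytope S = {x. \<forall>y\<in>S. x \<bullet> y \<le> 1}"

definition Gorenstein_Fano_polytope :: "(real ^ 'n) set \<Rightarrow> bool" where
  "Gorenstein_Fano_polytope S \<longleftrightarrow> Fano_polytope S \<and> integral_polytope (dual_polytope S)"

end

theory Submission
  imports Defs
begin

text \<open>
  Every point of the polytope \<open>\<Gamma>\<close> is a difference \<open>f - g\<close>, where \<open>f\<close> is nonnegative, order-reversing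
  and at most \<open>\<alpha>\<close>, where \<open>g\<close> is nonnegative with sum at most \<open>\<beta>\<close> over every chain, and where
  \<open>\<alpha> + \<beta> \<le> 1\<close>. If \<open>t (f - g)\<close> is integral then \<open>t f\<close> and \<open>t g\<close> may be replaced by their floors;
  an integral \<open>f\<close> is a sum of ideal vectors (its superlevel sets) and an integral \<open>g\<close> a sum of
  antichain vectors. So every integral point of \<open>t \<Gamma>\<close> is a sum of at most \<open>\<lfloor>t\<rfloor>\<close> generators of \<open>\<Gamma>\<close>.
  For integers \<open>t\<close> this is normality, for \<open>t < 1\<close> it excludes nonzero integral interior points,
  and in general it makes the gauge of \<open>\<Gamma>\<close>, which is the support function of the dual polytope,
  integral at integral points; hence the dual polytope has integral vertices.
\<close>

section \<open>Decomposition of integral functions into antichains and ideals\<close>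

definition chain_indices :: "('b \<times> 'b) set \<Rightarrow> ('n \<Rightarrow> 'b) \<Rightarrow> 'n set \<Rightarrow> bool" where
  "chain_indices r q C \<longleftrightarrow> (\<forall>i\<in>C. \<forall>j\<in>C. (q i, q j) \<in> r \<or> (q j, q i) \<in> r)"

lemma rho_nth: "rho p I $ i = (if p i \<in> I then 1 else 0)"
  by (simp add: rho_def axis_def)

lemma rho_empty [simp]: "rho p {} = 0"
  by (simp add: rho_def)

lemma sum_indicator_eq_card:
  fixes A :: "nat set"
  assumes "finite A"
  shows "(\<Sum>k\<in>A. if Pr k then 1 else 0 :: real) = real (card {k \<in> A. Pr k})"
  using assms by (simp add: sum.If_cases Int_def)

text \<open>A weighted form of Mirsky's theorem: if each \<open>q i\<close> is replaced by a chain
  of \<open>g i\<close> copies, then \<open>A k\<close> collects the elements that have a copy at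
  height \<open>k\<close>.\<close>

lemma antichain_decomposition:
  fixes g :: "'n::finite \<Rightarrow> nat" and q :: "'n \<Rightarrow> 'b"
  assumes r: "partial_order_on Q r" and q: "bij_betw q UNIV Q"
    and le: "\<And>C. chain_indices r q C \<Longrightarrow> sum g C \<le> n"
  obtains A where "\<And>k. A k \<in> antichains Q r" "\<And>i. card {k \<in> {1..n}. q i \<in> A k} = g i"
proof -
  have refl: "(q i, q i) \<in> r" for i
    using r q by (auto simp: partial_order_on_def preorder_on_def refl_on_def bij_betw_def)
  have trans: "trans r" and antisym: "antisym r"
    using r by (auto simp: partial_order_on_def preorder_on_def)
  have inj: "inj q" and qQ: "range q = Q" using q by (auto simp: bij_betw_def)
  \<comment> \<open>\<open>h i\<close> is the largest \<open>g\<close>-weight of a chain with all elements below \<open>q i\<close>; the intervals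
    \<open>{h i - g i<..h i}\<close> of comparable elements are disjoint.\<close>
  define \<C> where "\<C> i = {C. chain_indices r q C \<and> (\<forall>j\<in>C. (q j, q i) \<in> r)}" for i
  define h where "h i = Max (sum g ` \<C> i)" for i
  have fin: "finite (sum g ` \<C> i)" for i by simp
  have ub: "sum g C \<le> h i" if "C \<in> \<C> i" for C i
    unfolding h_def using that by (intro Max_ge) auto
  have attained: "\<exists>C\<in>\<C> i. h i = sum g C" for i
  proof -
    have "{} \<in> \<C> i" by (simp add: \<C>_def chain_indices_def)
    then have "h i \<in> sum g ` \<C> i" unfolding h_def by (intro Max_in fin) blast
    then show ?thesis by blast
  qed
  \<comment> \<open>The one-element chain shows that the truncated subtraction
    \<open>h i - g i\<close> is exact, so the interval attached to \<open>i\<close> has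
    \<open>g i\<close> elements.\<close>
  have gh: "g i \<le> h i" for i
    using ub[of "{i}" i] refl by (simp add: \<C>_def chain_indices_def)
  have hn: "h i \<le> n" for i using attained[of i] le by (auto simp: \<C>_def)
  have step: "h i + g j \<le> h j" if ij: "(q i, q j) \<in> r" "i \<noteq> j" for i j
  proof -
    \<comment> \<open>A heaviest chain below \<open>q i\<close> lies strictly below
      \<open>q j\<close>, so \<open>j\<close> extends it by weight \<open>g j\<close>.\<close>
    obtain C where C: "C \<in> \<C> i" "h i = sum g C" using attained by blast
    have "j \<notin> C"
    proof
      assume "j \<in> C"
      then have "(q j, q i) \<in> r" using C by (auto simp: \<C>_def)
      with ij antisym inj show False by (auto dest: antisymD injD)
    qed
    moreover have "insert j C \<in> \<C> j"
      using C(1) ij refl trans unfolding \<C>_def chain_indices_def by (auto dest: transD)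
    ultimately show ?thesis using ub[of "insert j C" j] C(2) by simp
  qed
  define A where "A k = q ` {i. h i - g i < k \<and> k \<le> h i}" for k
  have qA: "q i \<in> A k \<longleftrightarrow> h i - g i < k \<and> k \<le> h i" for i k
    using inj by (auto simp: A_def dest: injD)
  show thesis
  proof
    show "A k \<in> antichains Q r" for k
    proof -
      have "(q i, q j) \<notin> r" if "q i \<in> A k" "q j \<in> A k" "i \<noteq> j" for i j
        using step[of i j] that unfolding qA by fastforce
      then show ?thesis
        using qQ unfolding antichains_def A_def by fastforce
    qed
    show "card {k \<in> {1..n}. q i \<in> A k} = g i" for i
    proof -
      have "{k \<in> {1..n}. q i \<in> A k} = {h i - g i<..h i}"
        using hn[of i] by (auto simp: qA)
      then show ?thesis using gh[of i] by simp
    qed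
  qed
qed

text \<open>The superlevel sets of \<open>f\<close> are ideals because \<open>f\<close> reverses the
  order, and among those of levels 1 to \<open>m\<close> the element \<open>p i\<close> lies in the
  first \<open>f i\<close>.\<close>

lemma ideal_decomposition:
  fixes f :: "'n::finite \<Rightarrow> nat" and p :: "'n \<Rightarrow> 'a"
  assumes p: "bij_betw p UNIV P"
    and antitone: "\<And>i j. (p i, p j) \<in> r \<Longrightarrow> f j \<le> f i" and le: "\<And>i. f i \<le> m"
  obtains I where "\<And>k. I k \<in> poset_ideals P r" "\<And>i. card {k \<in> {1..m}. p i \<in> I k} = f i"
proof
  define I where "I k = p ` {i. k \<le> f i}" for k
  have pI: "p i \<in> I k \<longleftrightarrow> k \<le> f i" for i k
    using p by (auto simp: I_def bij_betw_def dest: injD)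
  show "I k \<in> poset_ideals P r" for k
    using p antitone unfolding poset_ideals_def I_def bij_betw_def
    by (force intro: order_trans)
  show "card {k \<in> {1..m}. p i \<in> I k} = f i" for i
  proof -
    have "{k \<in> {1..m}. p i \<in> I k} = {1..f i}"
      using le[of i] by (auto simp: pI)
    then show ?thesis by simp
  qed
qed

section \<open>Generators of the polytope and the splitting of its points\<close>

definition Gamma_generators ::
    "'a set \<Rightarrow> ('a \<times> 'a) set \<Rightarrow> ('n::finite \<Rightarrow> 'a) \<Rightarrow> 'b set \<Rightarrow> ('b \<times> 'b) set \<Rightarrow> ('n \<Rightarrow> 'b) \<Rightarrow>
     (real ^ 'n) set" where
  "Gamma_generators P r p Q s q =
     rho p ` poset_ideals P r \<union> uminus ` rho q ` antichains Q s"

lemma Gamma_polytope_eq_hull: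
  "Gamma_polytope (order_polytope P r p) (uminus ` chain_polytope Q s q) =
   convex hull Gamma_generators P r p Q s q"
proof -
  have "uminus ` chain_polytope Q s q = convex hull (uminus ` rho q ` antichains Q s)"
    unfolding chain_polytope_def by (intro convex_hull_linear_image linear_uminus)
  then show ?thesis
    unfolding Gamma_polytope_def order_polytope_def Gamma_generators_def
    by (metis hull_Un_left hull_Un_right)
qed

lemma finite_Gamma_generators:
  assumes "finite P" "finite Q"
  shows "finite (Gamma_generators P r p Q s q)"
proof -
  have "finite (poset_ideals P r)" "finite (antichains Q s)"
    using assms by (auto simp: poset_ideals_def antichains_def intro: finite_subset[of _ "Pow _"])
  then show ?thesis by (simp add: Gamma_generators_def)
qed

lemma Gamma_generators_integer: "Gamma_generators P r p Q s q \<subseteq> integer_points"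
  by (auto simp: Gamma_generators_def integer_points_def rho_nth)

lemma zero_in_Gamma_generators: "0 \<in> Gamma_generators P r p Q s q"
proof -
  have "rho p {} \<in> rho p ` poset_ideals P r"
    by (intro imageI) (simp add: poset_ideals_def)
  then show ?thesis by (simp add: Gamma_generators_def)
qed

text \<open>For partial orders these are Stanley's inequalities for the order polytope scaled by
  \<open>\<alpha>\<close> and the chain polytope scaled by \<open>\<beta>\<close>. Unlike membership
  in a hull, they survive rounding down.\<close>

definition Gamma_decomposition ::
    "('a \<times> 'a) set \<Rightarrow> ('n::finite \<Rightarrow> 'a) \<Rightarrow> ('b \<times> 'b) set \<Rightarrow> ('n \<Rightarrow> 'b) \<Rightarrow> real ^ 'n \<Rightarrow>
     real ^ 'n \<Rightarrow> real \<Rightarrow> real \<Rightarrow> bool" where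
  "Gamma_decomposition r p s q f g \<alpha> \<beta> \<longleftrightarrow>
     0 \<le> \<alpha> \<and> 0 \<le> \<beta> \<and> \<alpha> + \<beta> \<le> 1 \<and>
     (\<forall>i. 0 \<le> f $ i \<and> f $ i \<le> \<alpha> \<and> 0 \<le> g $ i) \<and>
     (\<forall>i j. (p i, p j) \<in> r \<longrightarrow> f $ j \<le> f $ i) \<and>
     (\<forall>C. chain_indices s q C \<longrightarrow> (\<Sum>i\<in>C. g $ i) \<le> \<beta>)"

text \<open>All constraints are linear in \<open>f\<close>, \<open>g\<close>,
  \<open>\<alpha>\<close> and \<open>\<beta>\<close> jointly, which is why the scales are variables
  and not fixed numbers.\<close>

lemma convex_Gamma_decomposition:
  "convex {x. \<exists>f g \<alpha> \<beta>. Gamma_decomposition r p s q f g \<alpha> \<beta> \<and> x = f - g}"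
proof (rule convexI, clarify)
  fix u v :: real and f g f' g' and \<alpha> \<beta> \<alpha>' \<beta>'
  assume uv: "0 \<le> u" "0 \<le> v" "u + v = 1"
    and d: "Gamma_decomposition r p s q f g \<alpha> \<beta>" and d': "Gamma_decomposition r p s q f' g' \<alpha>' \<beta>'"
  have "Gamma_decomposition r p s q (u *\<^sub>R f + v *\<^sub>R f') (u *\<^sub>R g + v *\<^sub>R g')
          (u * \<alpha> + v * \<alpha>') (u * \<beta> + v * \<beta>')"
    unfolding Gamma_decomposition_def
  proof (intro conjI allI impI)
    show "0 \<le> u * \<alpha> + v * \<alpha>'" "0 \<le> u * \<beta> + v * \<beta>'"
      using uv d d' by (auto simp: Gamma_decomposition_def)
    have "u * (\<alpha> + \<beta>) + v * (\<alpha>' + \<beta>') \<le> 1"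
      using uv d d' by (intro convex_bound_le) (auto simp: Gamma_decomposition_def)
    then show "u * \<alpha> + v * \<alpha>' + (u * \<beta> + v * \<beta>') \<le> 1" by (simp add: algebra_simps)
    show "0 \<le> (u *\<^sub>R f + v *\<^sub>R f') $ i" "(u *\<^sub>R f + v *\<^sub>R f') $ i \<le> u * \<alpha> + v * \<alpha>'"
      "0 \<le> (u *\<^sub>R g + v *\<^sub>R g') $ i" for i
      using uv d d' by (auto simp: Gamma_decomposition_def intro!: add_mono mult_left_mono)
    show "(u *\<^sub>R f + v *\<^sub>R f') $ j \<le> (u *\<^sub>R f + v *\<^sub>R f') $ i" if "(p i, p j) \<in> r" for i j
      using that uv d d' by (auto simp: Gamma_decomposition_def intro!: add_mono mult_left_mono)
    show "(\<Sum>i\<in>C. (u *\<^sub>R g + v *\<^sub>R g') $ i) \<le> u * \<beta> + v * \<beta>'" if "chain_indices s q C" for C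
      using that uv d d'
      by (auto simp: Gamma_decomposition_def sum.distrib simp flip: sum_distrib_left
          intro!: add_mono mult_left_mono)
  qed
  moreover have "u *\<^sub>R (f - g) + v *\<^sub>R (f' - g') =
      (u *\<^sub>R f + v *\<^sub>R f') - (u *\<^sub>R g + v *\<^sub>R g')"
    by (simp add: algebra_simps)
  ultimately show "\<exists>f'' g'' \<alpha> \<beta>. Gamma_decomposition r p s q f'' g'' \<alpha> \<beta> \<and>
      u *\<^sub>R (f - g) + v *\<^sub>R (f' - g') = f'' - g''"
    by blast
qed

text \<open>A chain and an antichain share at most one element.\<close>

lemma sum_antichain_chain_le_1:
  assumes "A \<in> antichains Q s" "bij_betw q UNIV Q" "chain_indices s q C"
  shows "(\<Sum>i\<in>C. rho q A $ i) \<le> 1"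
proof -
  have "card {i \<in> C. q i \<in> A} \<le> Suc 0"
    using assms unfolding antichains_def chain_indices_def bij_betw_def inj_def
    by (subst card_le_Suc0_iff_eq) (auto, blast)
  moreover have "(\<Sum>i\<in>C. rho q A $ i) = real (card {i \<in> C. q i \<in> A})"
    by (simp add: rho_nth sum.If_cases Int_def)
  ultimately show ?thesis by simp
qed

text \<open>By convexity it suffices to split the generators: ideal vectors with scales 1 and 0,
  negated antichain vectors with scales 0 and 1.\<close>

lemma Gamma_decomposition_exists:
  fixes p :: "'n::finite \<Rightarrow> 'a"
  assumes p: "bij_betw p UNIV P" and q: "bij_betw q UNIV Q"
    and x: "x \<in> convex hull Gamma_generators P r p Q s q"
  obtains f g \<alpha> \<beta> where "Gamma_decomposition r p s q f g \<alpha> \<beta>" "x = f - g"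
proof -
  let ?K = "{x. \<exists>f g \<alpha> \<beta>. Gamma_decomposition r p s q f g \<alpha> \<beta> \<and> x = f - g}"
  have "rho p I \<in> ?K" if "I \<in> poset_ideals P r" for I
  proof -
    have "Gamma_decomposition r p s q (rho p I) 0 1 0"
      using that p by (auto simp: Gamma_decomposition_def rho_nth poset_ideals_def bij_betw_def)
    then show ?thesis by force
  qed
  moreover have "- rho q A \<in> ?K" if "A \<in> antichains Q s" for A
  proof -
    have "Gamma_decomposition r p s q 0 (rho q A) 0 1"
      using sum_antichain_chain_le_1[OF that q] by (auto simp: Gamma_decomposition_def rho_nth)
    then show ?thesis by force
  qed
  ultimately have "Gamma_generators P r p Q s q \<subseteq> ?K"
    unfolding Gamma_generators_def by blast
  then have "convex hull Gamma_generators P r p Q s q \<subseteq> ?K"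
    by (intro hull_minimal convex_Gamma_decomposition)
  with x that show thesis by blast
qed

text \<open>After scaling by \<open>t\<close>, the coordinates of \<open>f\<close> and
  \<open>g\<close> differ by integers, so their fractional parts cancel and both may be rounded down
  without changing the difference. Rounding keeps the order reversal, and an integral chain sum
  bounded by \<open>t * \<beta>\<close> is bounded by its floor.\<close>

lemma integer_point_decomposition:
  fixes p :: "'n::finite \<Rightarrow> 'a" and q :: "'n \<Rightarrow> 'b"
  assumes p: "bij_betw p UNIV P" and s: "partial_order_on Q s" and q: "bij_betw q UNIV Q"
    and x: "x \<in> convex hull Gamma_generators P r p Q s q"
    and t: "0 \<le> t" and a: "t *\<^sub>R x \<in> integer_points"
  obtains b where "\<And>k. b k \<in> Gamma_generators P r p Q s q"
    "t *\<^sub>R x = (\<Sum>k = 1..nat \<lfloor>t\<rfloor>. b k)"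
proof -
  obtain f g \<alpha> \<beta> where d: "Gamma_decomposition r p s q f g \<alpha> \<beta>" and xfg: "x = f - g"
    using Gamma_decomposition_exists[OF p q x] by blast
  have nonneg: "0 \<le> f $ i" "0 \<le> g $ i" for i
    using d by (auto simp: Gamma_decomposition_def)
  define F where "F i = nat \<lfloor>t * f $ i\<rfloor>" for i
  define G where "G i = nat \<lfloor>t * g $ i\<rfloor>" for i
  define m where "m = nat \<lfloor>t * \<alpha>\<rfloor>"
  define n where "n = nat \<lfloor>t * \<beta>\<rfloor>"
  have FG: "real (F i) - real (G i) = (t *\<^sub>R x) $ i" for i
  proof -
    obtain z where z: "(t *\<^sub>R x) $ i = of_int z"
      using a by (auto simp: integer_points_def elim: Ints_cases)
    then have "t * f $ i = t * g $ i + of_int z" by (simp add: xfg algebra_simps)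
    then have "\<lfloor>t * f $ i\<rfloor> = \<lfloor>t * g $ i\<rfloor> + z" by simp
    moreover have "0 \<le> \<lfloor>t * f $ i\<rfloor>" "0 \<le> \<lfloor>t * g $ i\<rfloor>" using nonneg t by auto
    ultimately show ?thesis unfolding z by (simp add: F_def G_def)
  qed
  have mn: "m + n \<le> nat \<lfloor>t\<rfloor>"
  proof -
    have "0 \<le> \<alpha>" "0 \<le> \<beta>" "\<alpha> + \<beta> \<le> 1" using d by (auto simp: Gamma_decomposition_def)
    then have "t * \<alpha> + t * \<beta> \<le> t" and "0 \<le> t * \<alpha>" "0 \<le> t * \<beta>"
      using t mult_left_mono[of "\<alpha> + \<beta>" 1 t] by (auto simp: distrib_left)
    then have "\<lfloor>t * \<alpha>\<rfloor> + \<lfloor>t * \<beta>\<rfloor> \<le> \<lfloor>t\<rfloor>" "0 \<le> \<lfloor>t * \<alpha>\<rfloor>" "0 \<le> \<lfloor>t * \<beta>\<rfloor>"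
      by (auto intro: order_trans[OF le_floor_add] floor_mono)
    then show ?thesis by (metis m_def n_def nat_add_distrib nat_mono)
  qed
  have Fm: "F i \<le> m" for i
    using d t by (auto simp: F_def m_def Gamma_decomposition_def intro!: nat_mono floor_mono mult_left_mono)
  have antitone: "F j \<le> F i" if "(p i, p j) \<in> r" for i j
    using that d t
    by (auto simp: F_def Gamma_decomposition_def intro!: nat_mono floor_mono mult_left_mono)
  obtain I where I: "\<And>k. I k \<in> poset_ideals P r" "\<And>i. card {k \<in> {1..m}. p i \<in> I k} = F i"
    by (rule ideal_decomposition[of p P r F m, OF p antitone Fm]) blast+
  have chain: "sum G C \<le> n" if "chain_indices s q C" for C
  proof -
    have "real (G i) \<le> t * g $ i" for i
      using nonneg t by (simp add: G_def)
    then have "real (sum G C) \<le> t * (\<Sum>i\<in>C. g $ i)"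
      by (simp add: sum_distrib_left sum_mono)
    also have "\<dots> \<le> t * \<beta>"
      using that d t by (auto simp: Gamma_decomposition_def intro!: mult_left_mono)
    finally show ?thesis by (simp add: n_def le_nat_floor)
  qed
  obtain A where A: "\<And>k. A k \<in> antichains Q s" "\<And>i. card {k \<in> {1..n}. q i \<in> A k} = G i"
    by (rule antichain_decomposition[of Q s q G n, OF s q chain]) blast+
  \<comment> \<open>The first \<open>m\<close> terms are ideal vectors and the next \<open>n\<close>
    are negated antichain vectors, with index shifted by \<open>m\<close>; the remaining places up
    to the floor of \<open>t\<close> are filled with 0, itself a generator.\<close>
  define b where
    "b k = (if k \<le> m then rho p (I k) else if k \<le> m + n then - rho q (A (k - m)) else 0)" for k
  show thesis
  proof
    show "b k \<in> Gamma_generators P r p Q s q" for k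
      using I(1) A(1) zero_in_Gamma_generators[of P r p Q s q]
      by (auto simp: b_def Gamma_generators_def)
    have "(\<Sum>k = 1..nat \<lfloor>t\<rfloor>. b k) = (\<Sum>k = 1..m + n. b k)"
      using mn by (intro sum.mono_neutral_right) (auto simp: b_def)
    also have "\<dots> = (\<Sum>k = 1..m. b k) + (\<Sum>k = m + 1..m + n. b k)"
      by (intro sum.ub_add_nat) simp
    also have "(\<Sum>k = m + 1..m + n. b k) = (\<Sum>k = 1..n. b (k + m))"
      using sum.shift_bounds_cl_nat_ivl[of b 1 m n] by (simp add: add.commute)
    also have "\<dots> = (\<Sum>k = 1..n. - rho q (A k))"
      by (intro sum.cong) (auto simp: b_def)
    also have "(\<Sum>k = 1..m. b k) = (\<Sum>k = 1..m. rho p (I k))"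
      by (intro sum.cong) (auto simp: b_def)
    finally show "t *\<^sub>R x = (\<Sum>k = 1..nat \<lfloor>t\<rfloor>. b k)"
      using I(2) A(2) FG
      by (simp add: vec_eq_iff rho_nth sum_indicator_eq_card sum_negf del: vector_scaleR_component)
  qed
qed

section \<open>The interior of the polytope and the integrality of its dual\<close>

text \<open>The all-ones vector (the ideal \<open>P\<close>) and the vectors
  \<open>- axis i 1\<close> (the singleton antichains) are generators, and they span a simplex
  around the origin.\<close>

lemma zero_interior_Gamma:
  fixes p :: "'n::finite \<Rightarrow> 'a" and q :: "'n \<Rightarrow> 'b"
  assumes p: "bij_betw p UNIV P" and q: "bij_betw q UNIV Q"
  shows "0 \<in> interior (convex hull Gamma_generators P r p Q s q)" (is "0 \<in> interior ?H")
proof -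
  define c where "c = real CARD('n)"
  have c: "1 \<le> c" using one_le_card_finite[where 'a='n] by (simp add: c_def)
  have gens: "g \<in> ?H" if "g \<in> Gamma_generators P r p Q s q" for g
    using that by (rule hull_inc)
  have scale: "u *\<^sub>R g \<in> ?H" if "0 \<le> u" "u \<le> 1" "g \<in> ?H" for u g
    using that gens[OF zero_in_Gamma_generators] convexD_alt[OF convex_convex_hull, of 0 _ g u]
    by simp
  have one: "1 \<in> ?H"
  proof (rule gens)
    have "P \<in> poset_ideals P r" by (simp add: poset_ideals_def)
    moreover have "rho p P = 1" using p by (auto simp: vec_eq_iff rho_nth bij_betw_def)
    ultimately show "1 \<in> Gamma_generators P r p Q s q"
      unfolding Gamma_generators_def by (metis UnI1 imageI)
  qed
  have unit: "- axis i 1 \<in> ?H" for i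
  proof (rule gens)
    have "{q i} \<in> antichains Q s" using q by (auto simp: antichains_def bij_betw_def)
    moreover have "rho q {q i} = axis i 1"
      using q by (auto simp: vec_eq_iff rho_nth axis_def bij_betw_def dest: injD)
    ultimately show "- axis i 1 \<in> Gamma_generators P r p Q s q"
      unfolding Gamma_generators_def by (metis UnI2 imageI)
  qed
  \<comment> \<open>A point \<open>x\<close> of the ball is the midpoint of the constant vector
    \<open>1 / (2 * c)\<close> and of \<open>?y\<close>, whose entries
    \<open>2 * x $ i - 1 / (2 * c)\<close> lie between \<open>- 1 / c\<close> and 0. Hence
    \<open>?y\<close> is an average of \<open>c\<close> shrunken vectors
    \<open>- axis i 1\<close>.\<close>
  have "ball 0 (1 / (4 * c)) \<subseteq> ?H"
  proof
    fix x :: "real ^ 'n"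
    assume "x \<in> ball 0 (1 / (4 * c))"
    then have x: "\<bar>x $ i\<bar> \<le> 1 / (4 * c)" for i
      using component_le_norm_cart[of x i] by simp
    have "(\<Sum>i\<in>UNIV. (1 / c) *\<^sub>R ((1 / 2 - 2 * c * x $ i) *\<^sub>R - axis i 1)) \<in> ?H" (is "?y \<in> _")
    proof (intro convex_sum convex_convex_hull scale unit)
      show "0 \<le> 1 / 2 - 2 * c * x $ i" "1 / 2 - 2 * c * x $ i \<le> 1" for i
        using x[of i] c by (auto simp: field_simps abs_le_iff)
    qed (use c in \<open>auto simp: c_def\<close>)
    moreover have "(1 / (2 * c)) *\<^sub>R 1 \<in> ?H"
      using c by (intro scale one) (auto simp: field_simps)
    ultimately have "(1 / 2) *\<^sub>R ((1 / (2 * c)) *\<^sub>R 1) + (1 / 2) *\<^sub>R ?y \<in> ?H"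
      by (intro convexD[OF convex_convex_hull]) auto
    moreover have "?y $ i = 2 * x $ i - 1 / (2 * c)" for i
    proof -
      have "?y $ i = (\<Sum>j\<in>UNIV. if j = i then - (1 / c) * (1 / 2 - 2 * c * x $ i) else 0)"
        unfolding sum_component by (intro sum.cong) (auto simp: axis_def)
      then show ?thesis using c by (simp add: field_simps)
    qed
    then have "(1 / 2) *\<^sub>R ((1 / (2 * c)) *\<^sub>R 1) + (1 / 2) *\<^sub>R ?y = x"
      by (simp only: vec_eq_iff vector_add_component vector_scaleR_component one_index)
        (simp add: field_simps)
    ultimately show "x \<in> ?H" by simp
  qed
  then show ?thesis using c unfolding mem_interior by (intro exI[of _ "1 / (4 * c)"]) simp
qed

lemma dual_polytope_hull: "dual_polytope (convex hull S) = dual_polytope S"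
proof -
  have "convex hull S \<subseteq> {y. x \<bullet> y \<le> 1}" if "\<forall>y\<in>S. x \<bullet> y \<le> 1" for x
    using that by (intro hull_minimal convex_halfspace_le) auto
  then show ?thesis
    unfolding dual_polytope_def using hull_subset[of S convex] by blast
qed

text \<open>The dual is cut out by finitely many halfspaces, and a ball of radius \<open>e\<close>
  around 0 inside the hull bounds it by \<open>1 / e\<close>.\<close>

lemma polytope_dual_polytope:
  fixes S :: "(real ^ 'n) set"
  assumes "finite S" and int: "0 \<in> interior (convex hull S)"
  shows "polytope (dual_polytope S)"
proof -
  have "dual_polytope S = \<Inter>((\<lambda>y. {x. y \<bullet> x \<le> 1}) ` S)"
    by (auto simp: dual_polytope_def inner_commute)
  then have "polyhedron (dual_polytope S)"
    using \<open>finite S\<close> by (auto intro!: polyhedron_Inter polyhedron_halfspace_le)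
  moreover obtain e where e: "0 < e" "cball 0 e \<subseteq> convex hull S"
    using int by (auto simp: mem_interior_cball)
  have "norm x \<le> 1 / e" if "x \<in> dual_polytope S" for x
  proof (cases "x = 0")
    case False
    \<comment> \<open>\<open>x\<close> is tested against the point of the ball's boundary in its own
      direction.\<close>
    have "(e / norm x) *\<^sub>R x \<in> convex hull S"
      using e False by (intro subsetD[OF e(2)]) simp
    then have "x \<bullet> ((e / norm x) *\<^sub>R x) \<le> 1"
      using that by (subst (asm) dual_polytope_hull[symmetric]) (auto simp: dual_polytope_def)
    then have "e * norm x \<le> 1"
      using False by (simp add: dot_square_norm power2_eq_square)
    then show ?thesis using e by (simp add: field_simps)
  qed (use e in simp)
  then have "bounded (dual_polytope S)" unfolding bounded_iff by blast
  ultimately show ?thesis by (simp add: polytope_eq_bounded_polyhedron)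
qed

text \<open>The criterion of Edmonds and Giles: a vertex is the maximiser of both \<open>c\<close> and \<open>c + e\<^sub>i\<close> for some
  integral \<open>c\<close>, so its \<open>i\<close>-th coordinate is a difference of two integral maxima.\<close>

lemma integral_polytope_if_integer_maxima:
  fixes D :: "(real ^ 'n::finite) set"
  assumes "polytope D"
    and max: "\<And>c v. \<lbrakk>c \<in> integer_points; v \<in> D; \<And>y. y \<in> D \<Longrightarrow> c \<bullet> y \<le> c \<bullet> v\<rbrakk> \<Longrightarrow> c \<bullet> v \<in> \<int>"
  shows "integral_polytope D"
  unfolding integral_polytope_def
proof (intro conjI allI impI)
  show "polytope D" by fact
  fix v assume v: "v extreme_point_of D"
  obtain V where V: "finite V" "D = convex hull V"
    using \<open>polytope D\<close> by (auto simp: polytope_def)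
  define W where "W = V - {v}"
  have vD: "v \<in> D" using v by (simp add: extreme_point_of_def)
  have WD: "convex hull W \<subseteq> D" by (auto simp: V W_def intro!: hull_mono)
  have "v \<notin> convex hull W"
  proof
    assume "v \<in> convex hull W"
    \<comment> \<open>Extremality passes to a subset containing \<open>v\<close>, and extreme points
      of a hull belong to the generating set.\<close>
    then have "v extreme_point_of (convex hull W)"
      using v WD by (auto simp: extreme_point_of_def)
    then show False using extreme_point_of_convex_hull by (auto simp: W_def)
  qed
  moreover have "closed (convex hull W)"
    using V by (simp add: W_def compact_imp_closed finite_imp_compact_convex_hull)
  ultimately obtain a b where ab: "a \<bullet> v < b" "\<And>x. x \<in> convex hull W \<Longrightarrow> b < a \<bullet> x"
    using separating_hyperplane_closed_point[OF convex_convex_hull] by metis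
  \<comment> \<open>The functional \<open>- a\<close> has its strict maximum over \<open>V\<close>
    at \<open>v\<close>; a large multiple of it is now rounded to an integral
    \<open>c\<close>.\<close>
  define gap where "gap w = (- a) \<bullet> (v - w)" for w
  have gap: "0 < gap w" if "w \<in> W" for w
    using ab(1) ab(2)[OF hull_inc[OF that]] by (simp add: gap_def inner_diff_right)
  \<comment> \<open>Rounding the coefficients of \<open>- M * a\<close> costs at most
    \<open>L w\<close>, and adding \<open>axis i 1\<close> costs at most \<open>L w\<close> again;
    hence the factor 2 in the choice of \<open>M\<close>.\<close>
  define L where "L w = (\<Sum>i\<in>UNIV. \<bar>(v - w) $ i\<bar>)" for w
  obtain M where M: "\<And>w. w \<in> W \<Longrightarrow> 2 * L w / gap w \<le> M"
    using bdd_above_finite[of "(\<lambda>w. 2 * L w / gap w) ` W"] V by (auto simp: W_def bdd_above_def)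
  define c :: "real ^ 'n" where "c = (\<chi> i. of_int \<lfloor>- M * a $ i\<rfloor>)"
  have c_int: "c \<in> integer_points" by (simp add: c_def integer_points_def)
  have cw: "L w \<le> c \<bullet> (v - w)" if "w \<in> W" for w
  proof -
    have "2 * L w \<le> M * gap w" using M[OF that] gap[OF that] by (simp add: field_simps)
    moreover have "M * gap w - c \<bullet> (v - w) \<le> L w"
    proof -
      have "M * gap w - c \<bullet> (v - w) = (\<Sum>i\<in>UNIV. (- M * a $ i - c $ i) * (v - w) $ i)"
        by (simp add: gap_def inner_vec_def sum_distrib_left algebra_simps
            flip: sum_subtractf sum_negf)
      also have "\<dots> \<le> L w"
        unfolding L_def
      proof (rule sum_mono)
        fix i
        have "\<bar>- M * a $ i - c $ i\<bar> \<le> 1"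
          unfolding c_def by (simp add: abs_le_iff) linarith
        then have "\<bar>(- M * a $ i - c $ i) * (v - w) $ i\<bar> \<le> 1 * \<bar>(v - w) $ i\<bar>"
          unfolding abs_mult by (intro mult_right_mono) auto
        then show "(- M * a $ i - c $ i) * (v - w) $ i \<le> \<bar>(v - w) $ i\<bar>" by linarith
      qed
      finally show ?thesis .
    qed
    ultimately show ?thesis by linarith
  qed
  have maximal: "c' \<bullet> y \<le> c' \<bullet> v" if "y \<in> D" "\<And>w. w \<in> W \<Longrightarrow> 0 \<le> c' \<bullet> (v - w)" for c' y
  proof -
    have "D \<subseteq> {y. c' \<bullet> y \<le> c' \<bullet> v}"
      unfolding V(2) using that(2)
      by (intro hull_minimal convex_halfspace_le) (auto simp: W_def inner_diff_right)
    with that(1) show ?thesis by blast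
  qed
  have L: "\<bar>(v - w) $ i\<bar> \<le> L w" for w i
    unfolding L_def by (rule member_le_sum) auto
  have "c \<bullet> v \<in> \<int>"
  proof (rule max[OF c_int vD], rule maximal)
    show "0 \<le> c \<bullet> (v - w)" if "w \<in> W" for w
      using cw[OF that] L[of w] by (meson abs_ge_zero order_trans)
  qed
  moreover have "(c + axis i 1) \<bullet> v \<in> \<int>" for i
  proof (rule max[OF _ vD], goal_cases)
    case 1
    show ?case using c_int by (auto simp: integer_points_def axis_def)
  next
    case (2 y)
    then show ?case
    proof (rule maximal)
      show "0 \<le> (c + axis i 1) \<bullet> (v - w)" if "w \<in> W" for w
        using cw[OF that] L[of w i] by (simp add: inner_add_left inner_axis' abs_le_iff)
    qed
  qed
  ultimately have "(c + axis i 1) \<bullet> v - c \<bullet> v \<in> \<int>" for i by (intro Ints_diff)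
  then show "v \<in> integer_points"
    by (simp add: integer_points_def inner_add_left inner_axis')
qed

text \<open>A form of the bipolar theorem: a functional strictly separating \<open>a\<close> from
  the dilate of \<open>K\<close> is normalised to lie in the dual.\<close>

lemma separation_from_dilate:
  fixes K :: "(real ^ 'n) set"
  assumes K: "convex K" "closed K" "0 \<in> K" and t: "0 < t" and a: "a \<notin> (\<lambda>x. t *\<^sub>R x) ` K"
  obtains y where "y \<in> dual_polytope K" "t < a \<bullet> y"
proof -
  have "convex ((\<lambda>x. t *\<^sub>R x) ` K)" "closed ((\<lambda>x. t *\<^sub>R x) ` K)"
    using K by (auto intro: convex_scaling closed_scaling)
  then obtain u b where u: "u \<bullet> a < b" "\<And>x. x \<in> K \<Longrightarrow> b < u \<bullet> (t *\<^sub>R x)"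
    using separating_hyperplane_closed_point[OF _ _ a] by (metis image_eqI)
  \<comment> \<open>Since 0 lies in \<open>K\<close>, the level \<open>b\<close> is negative, so
    scaling by \<open>t / b\<close> reverses both separation inequalities.\<close>
  have b: "b < 0" using u(2)[OF K(3)] by simp
  show thesis
  proof
    show "(t / b) *\<^sub>R u \<in> dual_polytope K"
      using u(2) b by (auto simp: dual_polytope_def divide_simps less_imp_le mult.commute)
    have "t * b > t * (u \<bullet> a)" using u(1) t by simp
    then show "t < a \<bullet> ((t / b) *\<^sub>R u)"
      using b by (simp add: inner_commute divide_simps)
  qed
qed

text \<open>If an integral \<open>c\<close> has maximum \<open>t > 0\<close> over the dual, then
  \<open>c\<close> lies in the \<open>t\<close>-fold dilate by separation. It is thus a sum of as
  many generators as the floor of \<open>t\<close>, each pairing with the maximiser to at most 1, so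
  \<open>t\<close> is at most its floor.\<close>

lemma integral_dual_Gamma:
  fixes p :: "'n::finite \<Rightarrow> 'a" and q :: "'n \<Rightarrow> 'b"
  assumes p: "bij_betw p UNIV P" and s: "partial_order_on Q s" and q: "bij_betw q UNIV Q"
  shows "integral_polytope (dual_polytope (convex hull Gamma_generators P r p Q s q))"
    (is "integral_polytope (dual_polytope ?H)")
proof (rule integral_polytope_if_integer_maxima)
  let ?S = "Gamma_generators P r p Q s q"
  have "finite P" "finite Q" using p q by (auto simp: bij_betw_def)
  then have fin: "finite ?S" by (rule finite_Gamma_generators)
  show "polytope (dual_polytope ?H)"
    unfolding dual_polytope_hull using fin zero_interior_Gamma[OF p q]
    by (rule polytope_dual_polytope)
  fix c v
  assume c: "c \<in> integer_points" and v: "v \<in> dual_polytope ?H"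
    and max: "\<And>y. y \<in> dual_polytope ?H \<Longrightarrow> c \<bullet> y \<le> c \<bullet> v"
  have "c \<bullet> v \<ge> 0" using max[of 0] by (simp add: dual_polytope_def)
  show "c \<bullet> v \<in> \<int>"
  proof (cases "c \<bullet> v = 0")
    case False
    define t where "t = c \<bullet> v"
    have t: "0 < t" using False \<open>c \<bullet> v \<ge> 0\<close> by (simp add: t_def)
    have "c \<in> (\<lambda>x. t *\<^sub>R x) ` ?H"
    proof (rule ccontr)
      assume "c \<notin> (\<lambda>x. t *\<^sub>R x) ` ?H"
      then obtain y where "y \<in> dual_polytope ?H" "t < c \<bullet> y"
        using separation_from_dilate[of ?H t c] t fin zero_in_Gamma_generators
        by (metis convex_convex_hull hull_inc compact_imp_closed finite_imp_compact_convex_hull)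
      with max show False by (fastforce simp: t_def)
    qed
    then obtain x where x: "x \<in> ?H" "c = t *\<^sub>R x" by blast
    obtain b where b: "\<And>k. b k \<in> ?S" "c = (\<Sum>k = 1..nat \<lfloor>t\<rfloor>. b k)"
      using integer_point_decomposition[OF p s q x(1), of t] c t x(2) by auto
    have "b k \<bullet> v \<le> 1" for k
      using v b(1)[of k] by (auto simp: dual_polytope_def inner_commute hull_inc)
    then have "(\<Sum>k = 1..nat \<lfloor>t\<rfloor>. b k \<bullet> v) \<le> (\<Sum>k = 1..nat \<lfloor>t\<rfloor>. 1)"
      by (intro sum_mono)
    moreover have "t = (\<Sum>k = 1..nat \<lfloor>t\<rfloor>. b k \<bullet> v)"
      using arg_cong[OF b(2), of "\<lambda>x. x \<bullet> v"] by (simp add: t_def[symmetric] inner_sum_left)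
    ultimately have "t \<le> of_int \<lfloor>t\<rfloor>" using t by simp
    then have "t = of_int \<lfloor>t\<rfloor>" by (simp add: antisym)
    then show ?thesis unfolding t_def by (metis Ints_of_int)
  qed simp
qed

section \<open>Normality and the unique integral interior point\<close>

theorem corollary1p2:
  fixes P :: "'a set" and leP :: "('a \<times> 'a) set" and p :: "'n::finite \<Rightarrow> 'a"
    and Q :: "'b set" and leQ :: "('b \<times> 'b) set" and q :: "'n \<Rightarrow> 'b"
  assumes "partial_order_on P leP" and "bij_betw p UNIV P"
    and "partial_order_on Q leQ" and "bij_betw q UNIV Q"
  shows "normal_polytope
           (Gamma_polytope (order_polytope P leP p) (uminus ` chain_polytope Q leQ q)) \<and>
         Gorenstein_Fano_polytope
           (Gamma_polytope (order_polytope P leP p) (uminus ` chain_polytope Q leQ q))"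
proof -
  let ?S = "Gamma_generators P leP p Q leQ q"
  let ?H = "convex hull ?S"
  note decomp = integer_point_decomposition[OF assms(2-4), of _ leP]
  have "finite P" "finite Q" using assms by (auto simp: bij_betw_def)
  then have "finite ?S" by (rule finite_Gamma_generators)
  then have integral: "integral_polytope ?H"
    unfolding integral_polytope_def
    using Gamma_generators_integer extreme_point_of_convex_hull by (blast intro: polytope_convex_hull)
  have normal: "normal_polytope ?H"
    unfolding normal_polytope_def
  proof (intro conjI allI impI ballI)
    fix N :: nat and a
    assume "a \<in> (\<lambda>x. real N *\<^sub>R x) ` ?H \<inter> integer_points"
    then obtain x where x: "x \<in> ?H" "a = real N *\<^sub>R x" "a \<in> integer_points" by blast
    then obtain b where "\<And>k. b k \<in> ?S" "a = (\<Sum>k = 1..N. b k)"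
      using decomp[of x "real N"] by auto
    then show "\<exists>b. (\<forall>k\<in>{1..N}. b k \<in> ?H \<inter> integer_points) \<and> a = (\<Sum>k = 1..N. b k)"
      by (intro exI[of _ b]) (auto intro: hull_inc subsetD[OF Gamma_generators_integer])
  qed (rule integral)
  have zero: "0 \<in> interior ?H" by (rule zero_interior_Gamma[OF assms(2,4)])
  have "a = 0" if "a \<in> interior ?H" "a \<in> integer_points" for a
  proof (rule ccontr)
    assume "a \<noteq> 0"
    obtain e where e: "0 < e" "cball a e \<subseteq> ?H"
      using \<open>a \<in> interior ?H\<close> by (auto simp: mem_interior_cball)
    \<comment> \<open>Stretching \<open>a\<close> by \<open>u\<close> moves it by exactly
      \<open>e\<close>, so \<open>u *\<^sub>R a\<close> stays in \<open>?H\<close>. Then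
      \<open>a\<close> is an integral point of the dilate by \<open>1 / u < 1\<close>, hence an
      empty sum of generators.\<close>
    define u where "u = 1 + e / norm a"
    have u: "1 < u" using e \<open>a \<noteq> 0\<close> by (simp add: u_def)
    have "u *\<^sub>R a \<in> ?H"
      using e \<open>a \<noteq> 0\<close> by (intro subsetD[OF e(2)]) (simp add: u_def dist_norm algebra_simps)
    moreover have "(1 / u) *\<^sub>R (u *\<^sub>R a) = a" using u by simp
    ultimately obtain b where "a = (\<Sum>k = 1..nat \<lfloor>1 / u\<rfloor>. b k)"
      using decomp[of "u *\<^sub>R a" "1 / u"] \<open>a \<in> integer_points\<close> u by auto
    moreover have "\<lfloor>1 / u\<rfloor> = 0" using u by (simp add: floor_eq_iff)
    ultimately show False using \<open>a \<noteq> 0\<close> by simp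
  qed
  then have "interior ?H \<inter> integer_points = {0}"
    using zero by (auto simp: integer_points_def)
  then show ?thesis
    using normal integral integral_dual_Gamma[OF assms(2-4)]
    by (simp add: Gamma_polytope_eq_hull Gorenstein_Fano_polytope_def Fano_polytope_def)
qed

end
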